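(* Let $m>2$ and $k$ be integers with $0<k<2^m$ and $3 \mid k$, and let $N=k\cdot 2^m-1$. Suppose that one of the following holds: (i) $k \equiv 3 \pmod{42}$ and $m \equiv 0,2 \pmod{3}$; (ii) $k \equiv 9 \pmod{42}$ and $m \equiv 0 \pmod{3}$; (iii) $k \equiv 15 \pmod{42}$ and $m \equiv 1 \pmod{3}$; (iv) $k \equiv 27 \pmod{42}$ and $m \equiv 1,2 \pmod{3}$; (v) $k \equiv 33 \pmod{42}$ and $m \equiv 0,1 \pmod{3}$; (vi) $k \equiv 39 \pmod{42}$ and $m \equiv 2 \pmod{3}$. Let $x=V_k(5,1)$. Then $N$ is prime if and only if $N \mid S_{m-2}(x)$.
   Context: For $P,Q\in\mathbb{Z}$ the Lucas sequence $\{V_n(P,Q)\}$ is defined by $V_0(P,Q)=2$, $V_1(P,Q)=P$, $V_{n+1}(P,Q)=PV_n(P,Q)-QV_{n-1}(P,Q)$ for $n\ge 1$. For an integer $x$, the sequence $S_n(x)$ is defined by $S_0(x)=x$ and $S_{j+1}(x)=(S_j(x))^2-2$ for $j\ge 0$. *)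

theory Defs
  imports "HOL-Number_Theory.Number_Theory"
begin

fun lucas_V :: "int \<Rightarrow> int \<Rightarrow> nat \<Rightarrow> int" where
  "lucas_V P Q 0 = 2"
| "lucas_V P Q (Suc 0) = P"
| "lucas_V P Q (Suc (Suc n)) = P * lucas_V P Q (Suc n) - Q * lucas_V P Q n"

fun S_seq :: "nat \<Rightarrow> int \<Rightarrow> int" where
  "S_seq 0 x = x"
| "S_seq (Suc j) x = (S_seq j x)\<^sup>2 - 2"

end

theory Submission imports Defs
begin

text \<open>
  Let \<open>\<omega>\<close> be a root of \<open>X\<^sup>2 - 5 X + 1\<close> and \<open>\<omega>'\<close> its conjugate, so that
  \<open>V\<^sub>n(5, 1) = \<omega>\<^sup>n + \<omega>'\<^sup>n\<close> and \<open>S\<^sub>j(V\<^sub>k) = V\<^sub>t\<close> for \<open>t = 2\<^sup>j k\<close>. We compute modulo a prime \<open>p\<close> in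
  \<open>\<int>[\<omega>]\<close>, whose discriminant is 21. If \<open>N\<close> is prime, the congruences on \<open>k\<close> and \<open>m\<close> make 3 a square
  and 7 a non-square modulo \<open>N\<close>, so \<open>\<omega>\<^sup>N \<equiv> \<omega>'\<close>; comparing two evaluations of the \<open>(N + 1)\<close>-st
  power of \<open>1 + \<omega>\<close>, using \<open>(1 + \<omega>)\<^sup>2 = 7 \<omega>\<close> and \<open>(1 + \<omega>)(1 + \<omega>') = 7\<close>, gives
  \<open>\<omega>\<^sup>2\<^sup>t \<equiv> - 1\<close> for \<open>2 t = (N + 1) / 2\<close>, that is \<open>N\<close> divides \<open>V\<^sub>t\<close>. Conversely, if \<open>N\<close> divides \<open>V\<^sub>t\<close> then \<open>\<omega>\<^sup>k\<close>
  has order exactly \<open>2\<^sup>m\<close> modulo each prime factor \<open>p\<close> of \<open>N\<close>; this order divides \<open>p - 1\<close> or \<open>p + 1\<close>,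
  and a nontrivial factorisation of \<open>N\<close> would have size at least \<open>(2\<^sup>m - 1)(2\<^sup>m + 1) > N\<close>.
\<close>

section \<open>Congruences in commutative rings\<close>

text \<open>Divisibility of the difference makes sense in every commutative ring, in particular in
  \<open>zw\<close>, which has no \<open>mod\<close>.\<close>

definition cong_dvd :: "'a::comm_ring_1 \<Rightarrow> 'a \<Rightarrow> 'a \<Rightarrow> bool" where
  "cong_dvd d a b \<longleftrightarrow> d dvd a - b"

lemma cong_dvd_refl [simp]: "cong_dvd d a a"
  by (simp add: cong_dvd_def)

lemma cong_dvd_sym: "cong_dvd d a b \<Longrightarrow> cong_dvd d b a"
  unfolding cong_dvd_def by (metis dvd_minus_iff minus_diff_eq)

lemma cong_dvd_trans [trans]: "cong_dvd d a b \<Longrightarrow> cong_dvd d b c \<Longrightarrow> cong_dvd d a c"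
  unfolding cong_dvd_def by (metis dvd_add diff_add_cancel add_diff_eq)

lemma cong_dvd_add: "cong_dvd d a b \<Longrightarrow> cong_dvd d a' b' \<Longrightarrow> cong_dvd d (a + a') (b + b')"
  unfolding cong_dvd_def by (metis dvd_add add_diff_add)

lemma cong_dvd_mult: 
  assumes "cong_dvd d a b" "cong_dvd d a' b'"
  shows "cong_dvd d (a * a') (b * b')"
proof -
  have "a * a' - b * b' = a' * (a - b) + b * (a' - b')"
    by (simp add: algebra_simps)
  then show ?thesis
    using assms unfolding cong_dvd_def by simp
qed

lemma cong_dvd_power: "cong_dvd d a b \<Longrightarrow> cong_dvd d (a ^ n) (b ^ n)"
  by (induction n) (auto intro: cong_dvd_mult)

lemma cong_dvd_of_int:
  assumes "[a = b] (mod c)"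
  shows "cong_dvd (of_int c) (of_int a) (of_int b)"
proof -
  obtain e where "a - b = c * e"
    using assms by (auto simp: cong_iff_dvd_diff)
  then have "of_int a - of_int b = of_int c * (of_int e :: 'a)"
    by (metis of_int_diff of_int_mult)
  then show ?thesis
    unfolding cong_dvd_def by simp
qed

text \<open>All inner binomial coefficients \<open>p choose k\<close> with 0 < k < p are divisible
  by \<open>p\<close>.\<close>

lemma cong_dvd_prime_power_add:
  fixes a b :: "'a::comm_ring_1"
  assumes "prime p"
  shows "cong_dvd (of_nat p) ((a + b) ^ p) (a ^ p + b ^ p)"
proof -
  have p: "p > 0"
    using assms by (rule prime_gt_0_nat)
  have "{..p} = insert 0 (insert p {0<..<p})"
    using p by auto
  then have "(a + b) ^ p = a ^ p + b ^ p +
      (\<Sum>k\<in>{0<..<p}. of_nat (p choose k) * a ^ k * b ^ (p - k))"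
    using p by (simp add: binomial_ring)
  moreover have "of_nat p dvd (\<Sum>k\<in>{0<..<p}. of_nat (p choose k) * a ^ k * b ^ (p - k))"
  proof (rule dvd_sum)
    fix k assume "k \<in> {0<..<p}"
    then have "p dvd (p choose k)"
      using assms by (intro dvd_choose_prime) auto
    then show "of_nat p dvd of_nat (p choose k) * a ^ k * b ^ (p - k)"
      by (auto elim!: dvdE simp: mult.assoc)
  qed
  ultimately show ?thesis
    by (simp add: cong_dvd_def)
qed

section \<open>The ring generated by a root of \<open>X\<^sup>2 - 5 X + 1\<close>\<close>

text \<open>\<open>Zw a b\<close> stands for \<open>a + b \<omega>\<close>, where \<open>\<omega>\<^sup>2 = 5 \<omega> - 1\<close>.\<close>

datatype zw = Zw (zre: int) (zim: int)

instantiation zw :: comm_ring_1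
begin

definition "0 = Zw 0 0"
definition "1 = Zw 1 0"
definition "x + y = Zw (zre x + zre y) (zim x + zim y)"
definition "x - y = Zw (zre x - zre y) (zim x - zim y)"
definition "- x = Zw (- zre x) (- zim x)"
definition "x * y = Zw (zre x * zre y - zim x * zim y)
  (zre x * zim y + zim x * zre y + 5 * zim x * zim y)"

instance
  by standard
    (simp_all add: zero_zw_def one_zw_def plus_zw_def minus_zw_def uminus_zw_def times_zw_def
      zw.expand algebra_simps)

end

lemma of_int_zw: "of_int n = Zw n 0"
proof (induction n rule: int_induct[where k = 0])
  case base
  show ?case by (simp add: zero_zw_def)
next
  case (step1 i)
  then show ?case by (simp add: one_zw_def plus_zw_def)
next
  case (step2 i)
  then show ?case by (simp add: one_zw_def minus_zw_def)
qed

lemma numeral_zw: "numeral n = Zw (numeral n) 0"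
  using of_int_zw[of "numeral n"] by simp

lemma of_int_dvd_zw_iff: "of_int n dvd x \<longleftrightarrow> n dvd zre x \<and> n dvd zim x"
proof
  assume "of_int n dvd x"
  then show "n dvd zre x \<and> n dvd zim x"
    by (auto elim!: dvdE simp: of_int_zw times_zw_def)
next
  assume "n dvd zre x \<and> n dvd zim x"
  then obtain a b where "zre x = n * a" "zim x = n * b"
    by (auto elim!: dvdE)
  then have "x = of_int n * Zw a b"
    by (simp add: of_int_zw times_zw_def zw.expand)
  then show "of_int n dvd x" by simp
qed

text \<open>An integer factor acts on both coordinates separately, so cancellation reduces to the
  integers. This removes the factors 2 and -7 below.\<close>

lemma cong_dvd_zw_cancel:
  fixes x y :: zw
  assumes "coprime a n" "cong_dvd (of_int n) (of_int a * x) (of_int a * y)"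
  shows "cong_dvd (of_int n) x y"
proof -
  have "of_int n dvd of_int a * (x - y)"
    using assms(2) by (simp add: cong_dvd_def right_diff_distrib)
  then have "n dvd a * zre (x - y)" "n dvd a * zim (x - y)"
    unfolding of_int_dvd_zw_iff by (simp_all add: of_int_zw times_zw_def)
  then show ?thesis
    using assms(1) unfolding cong_dvd_def of_int_dvd_zw_iff
    by (simp add: coprime_dvd_mult_right_iff coprime_commute)
qed

definition om :: zw where "om = Zw 0 1"
definition om' :: zw where "om' = Zw 5 (- 1)"

lemma om_mult_om': "om * om' = 1"
  by (simp add: om_def om'_def times_zw_def one_zw_def)

lemma om_power_mult_om'_power: "om ^ n * om' ^ n = 1"
  by (simp add: om_mult_om' flip: power_mult_distrib)

lemma of_int_lucas_V: "of_int (lucas_V 5 1 n) = om ^ n + om' ^ n"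
proof (induction n rule: induct_nat_012)
  case 0
  show ?case by simp
next
  case 1
  show ?case by (simp add: om_def om'_def of_int_zw plus_zw_def numeral_zw)
next
  case (ge2 n)
  have *: "om * om = 5 * om - 1" "om' * om' = 5 * om' - 1"
    by (simp_all add: om_def om'_def times_zw_def numeral_zw one_zw_def minus_zw_def)
  have "om ^ Suc (Suc n) = 5 * om ^ Suc n - om ^ n"
    using arg_cong[OF *(1), of "\<lambda>u. u * om ^ n"] by (simp add: left_diff_distrib mult.assoc)
  moreover have "om' ^ Suc (Suc n) = 5 * om' ^ Suc n - om' ^ n"
    using arg_cong[OF *(2), of "\<lambda>u. u * om' ^ n"] by (simp add: left_diff_distrib mult.assoc)
  ultimately show ?case
    using ge2 by (simp add: right_diff_distrib distrib_left)
qed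

text \<open>Since \<open>om * om' = 1\<close>, squaring \<open>om ^ n + om' ^ n\<close> produces the
  cross term 2, which the recurrence of \<open>S_seq\<close> subtracts.\<close>

lemma of_int_S_seq:
  "of_int (S_seq j (lucas_V 5 1 k)) = om ^ (k * 2 ^ j) + om' ^ (k * 2 ^ j)"
proof (induction j)
  case 0
  show ?case by (simp add: of_int_lucas_V)
next
  case (Suc j)
  have "(om ^ n + om' ^ n)\<^sup>2 - 2 = om ^ (n * 2) + om' ^ (n * 2)" for n
    by (simp add: power2_sum power_mult mult.assoc om_power_mult_om'_power)
  from this[of "k * 2 ^ j"] Suc show ?case
    by (simp add: mult_ac)
qed

text \<open>\<open>om ^ t\<close> is a unit with inverse \<open>om' ^ t\<close>; multiplying by one
  or the other passes between \<open>om ^ t + om' ^ t\<close> and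
  \<open>om ^ (2 * t) + 1\<close>.\<close>

lemma dvd_S_seq_iff:
  "n dvd S_seq j (lucas_V 5 1 k) \<longleftrightarrow> cong_dvd (of_int n) (om ^ (2 * (k * 2 ^ j))) (- 1)"
proof -
  define t where "t = k * 2 ^ j"
  have "n dvd S_seq j (lucas_V 5 1 k) \<longleftrightarrow> of_int n dvd (of_int (S_seq j (lucas_V 5 1 k)) :: zw)"
    unfolding of_int_dvd_zw_iff by (simp add: of_int_zw)
  also have "\<dots> \<longleftrightarrow> of_int n dvd om ^ t + om' ^ t"
    by (simp add: of_int_S_seq t_def)
  also have "\<dots> \<longleftrightarrow> of_int n dvd om ^ (2 * t) + 1"
  proof
    assume "of_int n dvd om ^ t + om' ^ t"
    then have "of_int n dvd om ^ t * (om ^ t + om' ^ t)"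
      by (rule dvd_mult)
    then show "of_int n dvd om ^ (2 * t) + 1"
      by (simp add: ring_distribs om_power_mult_om'_power mult_2 power_add)
  next
    assume "of_int n dvd om ^ (2 * t) + 1"
    then have "of_int n dvd om' ^ t * (om ^ (2 * t) + 1)"
      by (rule dvd_mult)
    moreover have "om' ^ t * (om ^ (2 * t) + 1) = om ^ t * (om ^ t * om' ^ t) + om' ^ t"
      unfolding mult_2 power_add by (simp add: ring_distribs mult_ac)
    ultimately show "of_int n dvd om ^ t + om' ^ t"
      by (simp add: om_power_mult_om'_power)
  qed
  finally show ?thesis
    by (simp add: cong_dvd_def t_def)
qed

text \<open>The \<open>p\<close>-th power map is additive modulo \<open>p\<close>, so it fixes or
  exchanges the roots of the quadratic, according to the quadratic character \<open>s\<close> of the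
  discriminant 21.\<close>

lemma om_power_prime:
  fixes p :: nat
  assumes "prime p" "p > 2" "[21 ^ ((p - 1) div 2) = s] (mod int p)"
  shows "s = 1 \<Longrightarrow> cong_dvd (of_nat p) (om ^ p) om"
    and "s = - 1 \<Longrightarrow> cong_dvd (of_nat p) (om ^ p) om'"
proof -
  have odd: "odd p"
    using assms prime_odd_nat by blast
  then have p: "p = Suc (2 * ((p - 1) div 2))"
    by presburger
  define q where "q = (of_nat p :: zw)"
  have q: "q = of_int (int p)"
    by (simp add: q_def)
  \<comment> \<open>The form \<open>a ^ p = a\<close> also covers multiples of \<open>p\<close>,
    which occur for \<open>a = 5\<close>, \<open>p = 5\<close>.\<close>
  have fermat: "cong_dvd q (of_nat a ^ p) (of_nat a)" for a
  proof -
    have "[a ^ p = a] (mod p)"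
    proof (cases "p dvd a")
      case True
      then have "p dvd a ^ p"
        using assms(2) by (simp add: prime_dvd_power_nat_iff[OF assms(1)])
      with True show ?thesis
        by (simp add: cong_def)
    next
      case False
      then have "[a ^ (p - 1) * a = 1 * a] (mod p)"
        using assms(1) by (intro cong_mult fermat_theorem) auto
      then show ?thesis
        using assms(2) by (simp add: mult.commute flip: power_Suc)
    qed
    then have "[int (a ^ p) = int a] (mod int p)"
      by (simp only: cong_int_iff)
    then show ?thesis
      unfolding q using cong_dvd_of_int by fastforce
  qed
  \<comment> \<open>A square root of 21, so its \<open>p\<close>-th power is itself times Euler's
    power of 21.\<close>
  define d where "d = 2 * om - 5"
  have d2: "d\<^sup>2 = of_int 21"
    by (simp add: d_def om_def of_int_zw numeral_zw times_zw_def minus_zw_def power2_eq_square)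
  have "d ^ p = of_int (21 ^ ((p - 1) div 2)) * d"
    by (subst p) (simp add: power_mult d2)
  moreover have "cong_dvd q (of_int (21 ^ ((p - 1) div 2)) * d) (of_int s * d)"
    unfolding q using assms(3) by (intro cong_dvd_mult cong_dvd_of_int) auto
  ultimately have "cong_dvd q (d ^ p) (of_int s * d)"
    by simp
  moreover have "cong_dvd q ((d + 5) ^ p) (d ^ p + 5 ^ p)"
    unfolding q_def using assms(1) by (rule cong_dvd_prime_power_add)
  ultimately have "cong_dvd q ((d + 5) ^ p) (of_int s * d + 5)"
    using fermat[of 5] by (auto intro: cong_dvd_trans cong_dvd_add)
  moreover have "cong_dvd q (2 * om ^ p) ((d + 5) ^ p)"
    unfolding d_def using cong_dvd_mult[OF cong_dvd_sym[OF fermat[of 2]] cong_dvd_refl[of q "om ^ p"]]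
    by (simp add: power_mult_distrib)
  ultimately have main: "cong_dvd q (2 * om ^ p) (of_int s * d + 5)"
    using cong_dvd_trans by blast
  have cancel: "cong_dvd q x y" if "cong_dvd q (2 * x) (2 * y)" for x y
    using cong_dvd_zw_cancel[of 2 "int p" x y] that odd unfolding q by simp
  show "cong_dvd (of_nat p) (om ^ p) om" if "s = 1"
    using cancel[of "om ^ p" om] main that by (simp add: d_def q_def)
  show "cong_dvd (of_nat p) (om ^ p) om'" if "s = - 1"
  proof -
    have "of_int s * d + 5 = 2 * om'"
      using that by (simp add: d_def om_def om'_def of_int_zw numeral_zw times_zw_def minus_zw_def
          plus_zw_def one_zw_def uminus_zw_def)
    then show ?thesis
      using cancel[of "om ^ p" om'] main by (simp add: q_def)
  qed
qed

section \<open>Primality of \<open>k 2\<^sup>m - 1\<close>\<close>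

text \<open>Put \<open>h = (p - 1) div 2\<close>. The \<open>p\<close>-th power map sends
  \<open>1 + om\<close> to its conjugate, so \<open>(1 + om) ^ (p + 1)\<close> is the norm 7. As a
  power of \<open>(1 + om)\<^sup>2 = 7 * om\<close> it is also
  \<open>7 ^ h * 7 * om ^ Suc h\<close>, that is, \<open>- 7 * om ^ Suc h\<close>.\<close>

lemma om_half_power_prime:
  fixes p :: nat
  assumes p: "prime p" "p > 7" "p mod 4 = 3"
    and three: "[3 ^ ((p - 1) div 2) = 1] (mod int p)"
    and seven: "[7 ^ ((p - 1) div 2) = - 1] (mod int p)"
  shows "cong_dvd (of_int (int p)) (om ^ ((p + 1) div 2)) (- 1)"
proof -
  define h where "h = (p - 1) div 2"
  define q where "q = (of_int (int p) :: zw)"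
  have ph: "p + 1 = 2 * Suc h" and h: "(p + 1) div 2 = Suc h"
    using p unfolding h_def by presburger+
  \<comment> \<open>21 = 3 * 7 is thus a non-residue, and the \<open>p\<close>-th power map
    exchanges \<open>om\<close> and \<open>om'\<close>.\<close>
  have "[3 ^ h * 7 ^ h = 1 * (- 1)] (mod int p)"
    using three seven unfolding h_def by (rule cong_mult)
  then have "[21 ^ h = - 1] (mod int p)"
    by (simp flip: power_mult_distrib)
  then have "cong_dvd q (om ^ p) om'"
    using om_power_prime(2)[of p "- 1"] p by (simp add: h_def q_def)
  moreover have "cong_dvd q ((1 + om) ^ p) (1 ^ p + om ^ p)"
    unfolding q_def using cong_dvd_prime_power_add[OF p(1), of 1 om] by simp
  ultimately have "cong_dvd q ((1 + om) ^ p) (1 + om')"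
    by (metis power_one cong_dvd_add cong_dvd_refl cong_dvd_trans)
  then have "cong_dvd q ((1 + om) ^ p * (1 + om)) ((1 + om') * (1 + om))"
    by (rule cong_dvd_mult) simp
  moreover have "(1 + om') * (1 + om) = 7"
    by (simp add: om_def om'_def numeral_zw times_zw_def plus_zw_def one_zw_def)
  moreover have "(1 + om) ^ p * (1 + om) = of_int (7 ^ h) * (7 * om ^ Suc h)"
  proof -
    have "(1 + om)\<^sup>2 = 7 * om"
      by (simp add: om_def numeral_zw times_zw_def plus_zw_def one_zw_def power2_eq_square)
    then have "(1 + om) ^ (2 * Suc h) = (7 * om) ^ Suc h"
      by (simp only: power_mult)
    then show ?thesis
      unfolding ph[symmetric] by (simp add: power_mult_distrib mult_ac)
  qed
  ultimately have "cong_dvd q (of_int (7 ^ h) * (7 * om ^ Suc h)) 7"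
    by simp
  moreover have "cong_dvd q (of_int (7 ^ h) * (7 * om ^ Suc h)) (of_int (- 1) * (7 * om ^ Suc h))"
    unfolding q_def using seven by (intro cong_dvd_mult cong_dvd_of_int) (auto simp: h_def)
  ultimately have "cong_dvd q (of_int (- 1) * (7 * om ^ Suc h)) 7"
    using cong_dvd_sym cong_dvd_trans by blast
  then have "cong_dvd q (of_int (- 7) * om ^ Suc h) (of_int (- 7) * (- 1))"
    by simp
  moreover have "coprime (- 7) (int p)"
  proof -
    have "coprime 7 p"
      using p by (intro primes_coprime) auto
    then have "coprime (int 7) (int p)"
      by (simp only: coprime_int_iff)
    then show ?thesis by simp
  qed
  ultimately show ?thesis
    unfolding h q_def by (metis cong_dvd_zw_cancel)
qed

text \<open>\<open>om ^ k\<close> has order exactly \<open>2 ^ Suc m\<close> modulo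
  \<open>p\<close>, and \<open>om ^ (p - 1)\<close> or \<open>om ^ (p + 1)\<close> is 1 according to
  the character of 21.\<close>

lemma two_power_dvd_of_om_power:
  fixes p :: nat
  assumes p: "prime p" "p > 2" "\<not> p dvd 21"
    and om: "cong_dvd (of_int (int p)) (om ^ (k * 2 ^ m)) (- 1)"
  shows "2 ^ Suc m dvd p - 1 \<or> 2 ^ Suc m dvd p + 1"
proof -
  define q where "q = (of_int (int p) :: zw)"
  have dvd: "2 ^ Suc m dvd e" if e: "cong_dvd q (om ^ e) 1" for e
  proof (rule ccontr)
    assume not_dvd: "\<not> 2 ^ Suc m dvd e"
    \<comment> \<open>\<open>g\<close> is a power of 2 below \<open>2 ^ Suc m\<close>. Bezout over
      the naturals, hence without inverses, makes \<open>om ^ (k * g)\<close> equal to 1; then so is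
      \<open>om ^ (k * 2 ^ m)\<close>, which is also -1, and \<open>p\<close> divides 2.\<close>
    define g where "g = gcd (2 ^ Suc m) e"
    obtain x y where xy: "2 ^ Suc m * x = e * y + g"
      unfolding g_def using bezout_nat[of "2 ^ Suc m" e] by auto
    have "cong_dvd q ((om ^ (k * 2 ^ m)) ^ (2 * x)) ((- 1) ^ (2 * x))"
      using om cong_dvd_power unfolding q_def by blast
    moreover have "(om ^ (k * 2 ^ m)) ^ (2 * x) = om ^ (k * (2 ^ Suc m * x))"
      by (simp add: mult_ac flip: power_mult)
    ultimately have "cong_dvd q (om ^ (k * (e * y + g))) 1"
      unfolding xy by (simp add: power_mult)
    moreover have "om ^ (k * (e * y + g)) = (om ^ e) ^ (k * y) * om ^ (k * g)"
      by (simp add: algebra_simps flip: power_mult power_add)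
    moreover have "cong_dvd q ((om ^ e) ^ (k * y) * om ^ (k * g)) (1 ^ (k * y) * om ^ (k * g))"
      using e by (intro cong_dvd_mult cong_dvd_power) auto
    ultimately have g1: "cong_dvd q (om ^ (k * g)) 1"
      by (metis cong_dvd_sym cong_dvd_trans mult_1 power_one)
    obtain i where i: "i \<le> Suc m" "g = 2 ^ i"
      unfolding g_def using divides_primepow_nat[of 2 "gcd (2 ^ Suc m) e" "Suc m"] by auto
    have "i \<noteq> Suc m"
      using i not_dvd unfolding g_def by (metis gcd_dvd2)
    then have "m = i + (m - i)"
      using i by simp
    then have "2 ^ m = g * 2 ^ (m - i)"
      unfolding i(2) by (metis power_add)
    then have "cong_dvd q (om ^ (k * 2 ^ m)) (1 ^ (2 ^ (m - i)))"
      using cong_dvd_power[OF g1, of "2 ^ (m - i)"] by (simp add: mult_ac flip: power_mult)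
    then have "cong_dvd q 1 (- 1)"
      using om unfolding q_def by (metis cong_dvd_sym cong_dvd_trans power_one)
    then have "int p dvd 2"
      unfolding cong_dvd_def q_def of_int_dvd_zw_iff by (simp add: numeral_zw)
    then show False
      using p(2) by (auto dest: zdvd_imp_le)
  qed
  have "\<not> int p dvd 21"
    using p(3) by (metis int_dvd_int_iff of_nat_numeral)
  then have "Legendre 21 (int p) = 1 \<or> Legendre 21 (int p) = - 1"
    by (auto simp: Legendre_def cong_0_iff)
  moreover have "[21 ^ ((p - 1) div 2) = Legendre 21 (int p)] (mod int p)"
    using euler_criterion[OF p(1,2)] by (rule cong_sym)
  ultimately consider "cong_dvd q (om ^ p) om" | "cong_dvd q (om ^ p) om'"
    using om_power_prime[OF p(1,2)] unfolding q_def by fastforce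
  then show ?thesis
  proof cases
    case 1
    then have "cong_dvd q (om ^ p * om') (om * om')"
      by (rule cong_dvd_mult) simp
    moreover have "om ^ p = om ^ (p - 1) * om"
      using p(2) by (metis less_trans power_minus_mult zero_less_numeral)
    ultimately have "cong_dvd q (om ^ (p - 1)) 1"
      by (simp add: mult.assoc om_mult_om')
    then show ?thesis using dvd by blast
  next
    case 2
    then have "cong_dvd q (om ^ p * om) (om' * om)"
      by (rule cong_dvd_mult) simp
    then have "cong_dvd q (om ^ (p + 1)) 1"
      using om_mult_om' by (simp add: mult.commute)
    then show ?thesis using dvd by blast
  qed
qed

lemma prime_if_prime_factors_cong:
  fixes k M N :: int
  assumes N: "N = k * M - 1" "N > 1" and M: "M > 2" "k < M"
    and factors: "\<And>p. prime p \<Longrightarrow> p dvd N \<Longrightarrow> M dvd p - 1 \<or> M dvd p + 1"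
  shows "prime N"
proof -
  obtain p where p: "prime p" "p dvd N"
    using N(2) prime_factor_int[of N] by auto
  then obtain c where c: "N = p * c"
    by (elim dvdE)
  have "p > 1"
    using p by (simp add: prime_gt_1_int)
  then have "c > 0"
    using c N(2) by (metis less_trans zero_less_mult_pos zero_less_one)
  have pc: "M dvd p * c + 1"
    using c N(1) by (metis diff_add_cancel dvd_triv_right)
  have "c = 1"
  proof (rule ccontr)
    assume "c \<noteq> 1"
    then have "c > 1" using \<open>c > 0\<close> by simp
    \<comment> \<open>Since \<open>p * c\<close> is -1 modulo \<open>M\<close>, the cofactor
      \<open>c\<close> is 1 or -1 with sign opposite to that of \<open>p\<close>. The factor
      congruent to 1 exceeds 1, so it is at least \<open>M + 1\<close>; the other is at least
      \<open>M - 1\<close>.\<close>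
    have "(M - 1) * (M + 1) \<le> p * c"
      using factors[OF p]
    proof
      assume M1: "M dvd p - 1"
      then have "M dvd (p * c + 1) - (p - 1) * c"
        using pc by (intro dvd_diff) auto
      then have "M dvd c + 1"
        by (simp add: algebra_simps)
      then have "M + 1 \<le> p" "M - 1 \<le> c"
        using M1 \<open>p > 1\<close> \<open>c > 1\<close> by (auto dest!: zdvd_imp_le)
      then have "(M + 1) * (M - 1) \<le> p * c"
        using M by (intro mult_mono) auto
      then show ?thesis by (simp add: mult.commute)
    next
      assume M1: "M dvd p + 1"
      then have "M dvd (p + 1) * c - (p * c + 1)"
        using pc by (intro dvd_diff) auto
      then have "M dvd c - 1"
        by (simp add: algebra_simps)
      then have "M - 1 \<le> p" "M + 1 \<le> c"
        using M1 \<open>p > 1\<close> \<open>c > 1\<close> by (auto dest!: zdvd_imp_le)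
      then show ?thesis
        using M by (intro mult_mono) auto
    qed
    moreover have "k * M < M * M"
      using M by simp
    ultimately show False
      using c N(1) by (simp add: algebra_simps)
  qed
  then show ?thesis using c p by simp
qed

section \<open>Quadratic characters of 3 and 7, and powers of 2 modulo 7\<close>

lemma Legendre_3_7_eq:
  fixes p :: nat
  assumes p: "prime p" "p > 7" "p mod 4 = 3"
  shows "p mod 3 = 2 \<Longrightarrow> Legendre 3 (int p) = 1"
    and "p mod 7 \<in> {1, 2, 4} \<Longrightarrow> Legendre 7 (int p) = - 1"
proof -
  \<comment> \<open>3, 7 and \<open>p\<close> are all 3 modulo 4, so reciprocity changes the sign
    for both 3 and 7.\<close>
  have odd: "odd ((p - 1) div 2)"
    using p by presburger
  have "prime (7 :: nat)" "prime (3 :: nat)"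
    by auto
  have "Legendre 3 p * Legendre p 3 = - 1"
    using Quadratic_Reciprocity[of 3 p] p odd \<open>prime 3\<close> by simp
  moreover have "Legendre p 3 = - 1" if "p mod 3 = 2"
  proof -
    have "int p mod 3 = 2" using that by presburger
    moreover have "x\<^sup>2 mod 3 \<noteq> 2" for x :: int
    proof -
      have "x mod 3 \<in> {0, 1, 2}" by auto
      then have "(x mod 3)\<^sup>2 mod 3 \<noteq> 2" by auto
      then show ?thesis by (simp add: power_mod)
    qed
    ultimately show ?thesis
      by (auto simp: Legendre_def QuadRes_def cong_def)
  qed
  ultimately show "Legendre 3 (int p) = 1" if "p mod 3 = 2"
    using that by auto
  have "Legendre 7 p * Legendre p 7 = - 1"
    using Quadratic_Reciprocity[of 7 p] p odd \<open>prime 7\<close> by simp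
  moreover have "Legendre p 7 = 1" if "p mod 7 \<in> {1, 2, 4}"
  proof -
    have "int p mod 7 \<in> {1, 2, 4}"
      using that by (auto simp: zmod_int[of p 7, simplified, symmetric])
    \<comment> \<open>The squares of 1, 2, 3 are 1, 4, 2 modulo 7.\<close>
    then have "QuadRes 7 (int p)" "\<not> [int p = 0] (mod 7)"
      unfolding QuadRes_def cong_def
      by (auto intro: exI[of _ 1] exI[of _ 2] exI[of _ 3])
    then show ?thesis
      by (simp add: Legendre_def)
  qed
  ultimately show "Legendre 7 (int p) = - 1" if "p mod 7 \<in> {1, 2, 4}"
    using that by auto
qed

text \<open>8 is 1 modulo 7.\<close>

lemma two_power_mod_7: "(2 :: nat) ^ m mod 7 = 2 ^ (m mod 3) mod 7"
proof -
  have "(2 :: nat) ^ m = (2 ^ 3) ^ (m div 3) * 2 ^ (m mod 3)"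
    by (simp only: mult_div_mod_eq flip: power_mult power_add)
  moreover have "[(2 ^ 3) ^ (m div 3) * 2 ^ (m mod 3) = 1 ^ (m div 3) * 2 ^ (m mod 3)] (mod (7 :: nat))"
    by (intro cong_mult cong_pow) (auto simp: cong_def)
  ultimately show ?thesis
    by (simp add: cong_def)
qed

theorem theorem3p2:
  fixes k m :: nat and N x :: int
  assumes "m > 2"
    and "0 < k" and "k < 2 ^ m"
    and "3 dvd k"
    and "N = int k * 2 ^ m - 1"
    and "([k = 3] (mod 42) \<and> ([m = 0] (mod 3) \<or> [m = 2] (mod 3)))
       \<or> ([k = 9] (mod 42) \<and> [m = 0] (mod 3))
       \<or> ([k = 15] (mod 42) \<and> [m = 1] (mod 3))
       \<or> ([k = 27] (mod 42) \<and> ([m = 1] (mod 3) \<or> [m = 2] (mod 3)))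
       \<or> ([k = 33] (mod 42) \<and> ([m = 0] (mod 3) \<or> [m = 1] (mod 3)))
       \<or> ([k = 39] (mod 42) \<and> [m = 2] (mod 3))"
    and "x = lucas_V 5 1 k"
  shows "prime N \<longleftrightarrow> N dvd S_seq (m - 2) x"
proof -
  define n where "n = k * 2 ^ m - 1"
  have "3 \<le> k"
    using assms(2,4) by (auto dest: dvd_imp_le)
  have "(2 :: nat) ^ 3 dvd 2 ^ m"
    using assms(1) by (intro le_imp_power_dvd) simp
  then obtain c :: nat where c: "2 ^ m = 8 * c"
    by auto
  then have "c > 0"
    by (metis gr0I mult_0_right power_not_zero zero_neq_numeral)
  have n1: "n + 1 = k * 2 ^ m"
    using assms(2) by (simp add: n_def)
  have nN: "N = int n"
    using n1 assms(5) by (metis add_diff_cancel_right' of_nat_1 of_nat_add of_nat_mult of_nat_numeral of_nat_power)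
  have "3 * 8 \<le> k * 2 ^ m"
    using \<open>3 \<le> k\<close> \<open>c > 0\<close> unfolding c by (intro mult_le_mono) auto
  then have "n > 7"
    using n1 by simp
  have "n + 1 = 4 * (2 * k * c)"
    using n1 c by simp
  then have n4: "n mod 4 = 3"
    by presburger
  have "3 dvd n + 1"
    using n1 assms(4) by simp
  then have n3: "n mod 3 = 2"
    by presburger
  have k7: "k mod 7 = k mod 42 mod 7"
    by (simp add: mod_mod_cancel)
  have "(n + 1) mod 7 = (k mod 7) * (2 ^ m mod 7) mod 7"
    unfolding n1 by (simp add: mod_mult_eq)
  also have "\<dots> = (k mod 42 mod 7) * (2 ^ (m mod 3) mod 7) mod 7"
    by (simp only: k7[symmetric] two_power_mod_7[symmetric])
  \<comment> \<open>The six cases on \<open>k\<close> and \<open>m\<close> serve to make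
    \<open>n\<close> a nonzero square modulo 7.\<close>
  also have "\<dots> \<in> {2, 3, 5}"
    using assms(6) by (auto simp: cong_def)
  finally have n7: "n mod 7 \<in> {1, 2, 4}"
    by (simp only: insert_iff empty_iff) presburger
  have m: "m = Suc (Suc (m - 2))"
    using assms(1) by simp
  \<comment> \<open>The exponent is \<open>(n + 1) div 2\<close>. The divisor \<open>d\<close> is
    left free: it is \<open>N\<close> in one direction and a prime factor of \<open>N\<close> in the
    other.\<close>
  have iff: "d dvd S_seq (m - 2) x \<longleftrightarrow> cong_dvd (of_int d) (om ^ (k * 2 ^ (m - 1))) (- 1)" for d
  proof -
    have "2 * (k * 2 ^ (m - 2)) = k * 2 ^ (m - 1)"
      using m by (metis diff_Suc_1 mult.left_commute power_Suc)
    then show ?thesis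
      unfolding assms(7) dvd_S_seq_iff by (simp only:)
  qed
  show ?thesis
  proof
    assume "prime N"
    then have n: "prime n"
      by (simp add: nN)
    then have "[3 ^ ((n - 1) div 2) = 1] (mod int n)" "[7 ^ ((n - 1) div 2) = - 1] (mod int n)"
      using euler_criterion[of n 3] euler_criterion[of n 7] Legendre_3_7_eq[OF n] n3 n4 n7 \<open>n > 7\<close>
      by (auto intro: cong_sym)
    then have "cong_dvd (of_int (int n)) (om ^ ((n + 1) div 2)) (- 1)"
      using n n4 \<open>n > 7\<close> by (intro om_half_power_prime)
    moreover have "n + 1 = 2 * (k * 2 ^ (m - 1))"
      unfolding n1 using m by (metis diff_Suc_1 mult.left_commute power_Suc)
    then have "(n + 1) div 2 = k * 2 ^ (m - 1)"
      by simp
    ultimately show "N dvd S_seq (m - 2) x"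
      unfolding iff nN by simp
  next
    assume dvd: "N dvd S_seq (m - 2) x"
    show "prime N"
    proof (rule prime_if_prime_factors_cong[of N "int k" "2 ^ m"])
      show "N = int k * 2 ^ m - 1" by fact
      show "N > 1" using nN \<open>n > 7\<close> by simp
      show "(2 :: int) < 2 ^ m"
        using assms(1) power_strict_increasing[of 1 m "2 :: int"] by simp
      show "int k < 2 ^ m"
        using assms(3) by (metis of_nat_less_iff of_nat_numeral of_nat_power)
    next
      fix p :: int
      assume p: "prime p" "p dvd N"
      define r where "r = nat p"
      have "p = int r"
        using p(1) by (simp add: r_def prime_ge_0_int)
      then have r: "p = int r" "prime r" "r dvd n"
        using p by (simp_all add: nN)
      \<comment> \<open>The residues of \<open>n\<close> modulo 4, 3 and 7 exclude the prime 2 and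
        the primes dividing the discriminant 21.\<close>
      have "\<not> 2 dvd n"
        using n4 by presburger
      moreover have "\<not> 3 dvd n" "\<not> 7 dvd n"
        using n3 n7 by (auto simp: dvd_eq_mod_eq_0)
      ultimately have "r \<noteq> 2" "r \<noteq> 3" "r \<noteq> 7"
        using r(3) by auto
      have "\<not> r dvd 21"
      proof
        assume "r dvd 21"
        then have "r dvd 3 * 7" by simp
        then have "r dvd 3 \<or> r dvd 7"
          using r(2) prime_dvd_mult_iff by blast
        moreover have "prime (7 :: nat)" "prime (3 :: nat)"
          by auto
        ultimately show False
          using r(2) \<open>r \<noteq> 3\<close> \<open>r \<noteq> 7\<close> primes_dvd_imp_eq by blast
      qed
      moreover have "r > 2"
        using r(2) \<open>r \<noteq> 2\<close> prime_ge_2_nat[of r] by simp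
      moreover have "p dvd S_seq (m - 2) x"
        using p(2) dvd by (rule dvd_trans)
      ultimately have "2 ^ Suc (m - 1) dvd r - 1 \<or> 2 ^ Suc (m - 1) dvd r + 1"
        using r(1,2) unfolding iff by (intro two_power_dvd_of_om_power) auto
      moreover have "Suc (m - 1) = m"
        using assms(1) by simp
      ultimately have "int (2 ^ m) dvd int (r - 1) \<or> int (2 ^ m) dvd int (r + 1)"
        by (simp only: int_dvd_int_iff)
      then show "2 ^ m dvd p - 1 \<or> 2 ^ m dvd p + 1"
        using r(1) \<open>r > 2\<close> by (simp add: of_nat_diff add.commute)
    qed
  qed
qed

end
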